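(* Let $\pi\in\Pi_0$ be such that $x_{\mathsf e}=0$ is globally attractive under $\pi$. If there exists a function $v:\mathcal X\to\mathbb R$ such that $v$ is continuous at $0$, $v(0)=0$, and either (i) for a fixed $\eta>0$, $v(x)=\mathbb G_\pi^x\big[\int_0^\eta\gamma^tR_t\,dt+\gamma^\eta v(X_\eta)\big]$ for all $x\in\mathcal X$, or (ii) $v\in\mathrm C^1$ and $\alpha v(x)=h(x,\pi(x),\nabla v(x))$ for all $x\in\mathcal X$, then $\pi\in\Pi_{\mathsf a}$ and $v=v_\pi$.
   Context: Nonlinear optimal control setting. State space $\mathcal X=\mathbb R^l$, $\mathcal X^{\mathsf T}=\mathbb R^{1\times l}$, time space $\mathbb T=[0,\infty)$; the action space $\mathcal U\subseteq\mathbb R^m$ (a set $O\cup\partial O$ or $O$ with $O$ open in $\mathbb R^m$) contains $0$. The system is $\dot X_t=f(X_t,U_t)$ with $f:\mathcal X\times\mathcal U\to\mathcal X$ locally Lipschitz and $f(0,0)=0$. The cost function $c:\mathcal X\times\mathcal U\to\mathbb R$ is continuous and positive definite: $c(0,0)=0$ and $c(x,u)>0$ for $(x,u)\ne(0,0)$; the reward is $r=-c$, $R_t=r(X_t,U_t)$, $C_t=-R_t$. $\gamma\in(0,1]$ is the discount factor, $\alpha=-\ln\gamma\ge0$. The Hamiltonian is $h(x,u,p)=r(x,u)+p\,f(x,u)$ (gradients are row vectors), and it is assumed there is a locally Lipschitz $u_*:\mathcal X\times\mathcal X^{\mathsf T}\to\mathcal U$ with $u_*(x,p)\in\arg\max_{u\in\mathcal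 U}h(x,u,p)$ for all $(x,p)$. A policy is a continuous function $\pi:\mathcal X\to\mathcal U$; write $f_\pi(x)=f(x,\pi(x))$, $c_\pi(x)=c(x,\pi(x))$. $\Pi_0$ is the set of locally Lipschitz policies with $\pi(0)=0$. For a locally Lipschitz policy $\pi$ and $x\in\mathcal X$, $[0,t_{\mathsf{max}}(x;\pi))$ with $t_{\mathsf{max}}(x;\pi)\in(0,\infty]$ is the maximal forward existence interval of the unique solution of $\dot X_t=f_\pi(X_t)$, $X_0=x$ (global existence is not assumed); $\mathbb G_\pi^x[Y]$ denotes the value of $Y$ along that solution with $U_t=\pi(X_t)$. The cost value function is $J_\pi(x)=\mathbb G_\pi^x[\int_0^\infty\gamma^tC_t\,dt]\in[0,\infty]$ if $t_{\mathsf{max}}(x;\pi)=\infty$ and $J_\pi(x)=\infty$ otherwise; $v_\pi=-J_\pi$. $\Pi_{\mathsf a}=\{\pi\in\Pi_0: J_\pi(x)<\infty\ \forall x\in\mathcal X\}$ (assumed nonempty). Standing assumptions: for every $\pi\in\Pi_{\mathsf a}$, $v_\pi$ is $\mathrm C^1$ with locally Lipschitz gradient; for every $\pi\in\Pi_0$, $c_\pi$ is radially nonvanishing, i.e., $\inf_{\|x\|\ge\rho}|c_\pi(x)|\not\to0$ as $\rho\to\infty$. $x_{\mathsf e}=0$ is globally attractive under $\pi$ iff $t_{\mathsf{max}}(x;\pi)=\infty$ and $\lim_{t\to\infty}\mathbb G_\pi^x[X_t]=0$ for all $x\in\mathcal X$. *)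

theory Defs
  imports "HOL-Analysis.Analysis"
begin

text \<open>Row vectors (gradients, costates) are elements of \<open>real ^ 'l\<close>; the product of a row vector
  with a column vector is the inner product.\<close>

definition locally_lipschitz_on :: "'a::metric_space set \<Rightarrow> ('a \<Rightarrow> 'b::metric_space) \<Rightarrow> bool" where
  "locally_lipschitz_on S g \<longleftrightarrow>
     (\<forall>z\<in>S. \<exists>\<epsilon>>0. \<exists>L. L-lipschitz_on (cball z \<epsilon> \<inter> S) g)"

definition gradient :: "('a::real_inner \<Rightarrow> real) \<Rightarrow> 'a \<Rightarrow> 'a" where
  "gradient v x = (THE D. GDERIV v x :> D)"

definition C1 :: "('a::real_inner \<Rightarrow> real) \<Rightarrow> bool" where
  "C1 v \<longleftrightarrow> (\<forall>x. \<exists>D. GDERIV v x :> D) \<and> continuous_on UNIV (gradient v)"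

definition forward_solution ::
    "('a::real_normed_vector \<Rightarrow> 'a) \<Rightarrow> 'a \<Rightarrow> ereal \<Rightarrow> (real \<Rightarrow> 'a) \<Rightarrow> bool" where
  "forward_solution F x T X \<longleftrightarrow>
     X 0 = x \<and>
     (\<forall>t\<ge>0. ereal t < T \<longrightarrow> (X has_vector_derivative F (X t)) (at t within {0..}))"

definition t_max :: "('a::real_normed_vector \<Rightarrow> 'a) \<Rightarrow> 'a \<Rightarrow> ereal" where
  "t_max F x = Sup {T. 0 < T \<and> (\<exists>X. forward_solution F x T X)}"

text \<open>The state at time \<open>t\<close> of the unique solution started in \<open>x\<close>; meaningful for locally Lipschitz
  \<open>F\<close> and \<open>0 \<le> t < t_max F x\<close> only.\<close>

definition trajectory :: "('a::real_normed_vector \<Rightarrow> 'a) \<Rightarrow> 'a \<Rightarrow> real \<Rightarrow> 'a" where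
  "trajectory F x t = (THE y. \<exists>T X. ereal t < T \<and> forward_solution F x T X \<and> X t = y)"

definition globally_attractive :: "('a::real_normed_vector \<Rightarrow> 'a) \<Rightarrow> bool" where
  "globally_attractive F \<longleftrightarrow>
     (\<forall>x. t_max F x = \<infinity> \<and> (trajectory F x \<longlongrightarrow> 0) at_top)"

definition action_space :: "(real ^ 'm) set \<Rightarrow> bool" where
  "action_space U \<longleftrightarrow> (\<exists>G. open G \<and> (U = G \<or> U = G \<union> frontier G)) \<and> 0 \<in> U"

definition positive_definite_on :: "'z::zero set \<Rightarrow> ('z \<Rightarrow> real) \<Rightarrow> bool" where
  "positive_definite_on S c \<longleftrightarrow> c 0 = 0 \<and> (\<forall>z\<in>S. z \<noteq> 0 \<longrightarrow> 0 < c z)"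

definition policies :: "(real ^ 'm) set \<Rightarrow> (real ^ 'l \<Rightarrow> real ^ 'm) set" where
  "policies U = {\<pi>. continuous_on UNIV \<pi> \<and> (\<forall>x. \<pi> x \<in> U)}"

definition Pi0 :: "(real ^ 'm) set \<Rightarrow> (real ^ 'l \<Rightarrow> real ^ 'm) set" where
  "Pi0 U = {\<pi> \<in> policies U. locally_lipschitz_on UNIV \<pi> \<and> \<pi> 0 = 0}"

text \<open>For \<open>g\<close> on state-action pairs this is \<open>g\<^sub>\<pi>(x) = g(x, \<pi>(x))\<close>.\<close>

definition closed_loop :: "('x \<times> 'u \<Rightarrow> 'b) \<Rightarrow> ('x \<Rightarrow> 'u) \<Rightarrow> 'x \<Rightarrow> 'b" where
  "closed_loop g \<pi> x = g (x, \<pi> x)"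

definition reward :: "('z \<Rightarrow> real) \<Rightarrow> 'z \<Rightarrow> real" where
  "reward c z = - c z"

definition hamiltonian ::
    "((real ^ 'l) \<times> (real ^ 'm) \<Rightarrow> real ^ 'l) \<Rightarrow> ((real ^ 'l) \<times> (real ^ 'm) \<Rightarrow> real)
     \<Rightarrow> real ^ 'l \<Rightarrow> real ^ 'm \<Rightarrow> real ^ 'l \<Rightarrow> real" where
  "hamiltonian f c x u p = reward c (x, u) + p \<bullet> f (x, u)"

text \<open>The cost is nonnegative along every policy with values in the action space, so truncation
  by \<open>ennreal\<close> is harmless.\<close>

definition cost_value ::
    "((real ^ 'l) \<times> (real ^ 'm) \<Rightarrow> real ^ 'l) \<Rightarrow> ((real ^ 'l) \<times> (real ^ 'm) \<Rightarrow> real) \<Rightarrow> real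
     \<Rightarrow> (real ^ 'l \<Rightarrow> real ^ 'm) \<Rightarrow> real ^ 'l \<Rightarrow> ennreal" where
  "cost_value f c \<gamma> \<pi> x =
     (if t_max (closed_loop f \<pi>) x = \<infinity>
      then \<integral>\<^sup>+t\<in>{0..}. ennreal (\<gamma> powr t * closed_loop c \<pi> (trajectory (closed_loop f \<pi>) x t)) \<partial>lborel
      else \<infinity>)"

definition value_function ::
    "((real ^ 'l) \<times> (real ^ 'm) \<Rightarrow> real ^ 'l) \<Rightarrow> ((real ^ 'l) \<times> (real ^ 'm) \<Rightarrow> real) \<Rightarrow> real
     \<Rightarrow> (real ^ 'l \<Rightarrow> real ^ 'm) \<Rightarrow> real ^ 'l \<Rightarrow> ereal" where
  "value_function f c \<gamma> \<pi> x = - enn2ereal (cost_value f c \<gamma> \<pi> x)"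

definition admissible ::
    "(real ^ 'm) set \<Rightarrow> ((real ^ 'l) \<times> (real ^ 'm) \<Rightarrow> real ^ 'l) \<Rightarrow> ((real ^ 'l) \<times> (real ^ 'm) \<Rightarrow> real)
     \<Rightarrow> real \<Rightarrow> (real ^ 'l \<Rightarrow> real ^ 'm) set" where
  "admissible U f c \<gamma> = {\<pi> \<in> Pi0 U. \<forall>x. cost_value f c \<gamma> \<pi> x < \<infinity>}"

definition radially_nonvanishing :: "('a::real_normed_vector \<Rightarrow> real) \<Rightarrow> bool" where
  "radially_nonvanishing g \<longleftrightarrow>
     \<not> ((\<lambda>\<rho>::real. INF x\<in>{x. \<rho> \<le> norm x}. \<bar>g x\<bar>) \<longlongrightarrow> 0) at_top"

end

theory Submission
  imports Defs
begin

text \<open>Under either hypothesis the Bellman equation \<open>v(x) = -\<integral>\<^sub>0\<^sup>\<eta> \<gamma>\<^sup>t c dt + \<gamma>\<^sup>\<eta> v(X\<^sub>\<eta>)\<close> holds for some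
  \<open>\<eta> > 0\<close>: in the differential case, \<open>\<gamma>\<^sup>t c\<close> is the derivative of \<open>\<gamma>\<^sup>t v(X\<^sub>t)\<close>. By the flow property
  it iterates to the horizons \<open>n \<eta>\<close>. Attractivity together with continuity of \<open>v\<close> at the origin
  makes the terminal term vanish as \<open>n \<rightarrow> \<infinity>\<close>, so by monotone convergence the total discounted cost
  is \<open>-v(x)\<close>, which is finite.\<close>

section \<open>Local Lipschitz continuity under pairing, composition and on compact sets\<close>

lemma lipschitz_on_imp_locally_lipschitz_on:
  "L-lipschitz_on S g \<Longrightarrow> locally_lipschitz_on S g"
  unfolding locally_lipschitz_on_def
  by (meson inf_le2 lipschitz_on_subset zero_less_one)

lemma locally_lipschitz_on_Pair:
  assumes "locally_lipschitz_on S g" "locally_lipschitz_on S h"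
  shows "locally_lipschitz_on S (\<lambda>x. (g x, h x))"
  unfolding locally_lipschitz_on_def
proof
  fix z assume z: "z \<in> S"
  obtain d L where d: "d > 0" "L-lipschitz_on (cball z d \<inter> S) g"
    using assms(1) z unfolding locally_lipschitz_on_def by blast
  obtain e M where e: "e > 0" "M-lipschitz_on (cball z e \<inter> S) h"
    using assms(2) z unfolding locally_lipschitz_on_def by blast
  have "(sqrt (L\<^sup>2 + M\<^sup>2))-lipschitz_on (cball z (min d e) \<inter> S) (\<lambda>x. (g x, h x))"
    by (intro lipschitz_on_Pair lipschitz_on_subset[OF d(2)] lipschitz_on_subset[OF e(2)]) auto
  then show "\<exists>\<epsilon>>0. \<exists>L. L-lipschitz_on (cball z \<epsilon> \<inter> S) (\<lambda>x. (g x, h x))"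
    using d(1) e(1) by (meson min_less_iff_conj)
qed

text \<open>Combined with pairing, this makes \<open>closed_loop f \<pi>\<close> locally Lipschitz
  although \<open>f\<close> is assumed so only on \<open>UNIV \<times> U\<close>.\<close>

lemma locally_lipschitz_on_compose:
  assumes h: "locally_lipschitz_on T h" and g: "locally_lipschitz_on S g" and sub: "h ` T \<subseteq> S"
  shows "locally_lipschitz_on T (\<lambda>x. g (h x))"
  unfolding locally_lipschitz_on_def
proof
  fix z assume z: "z \<in> T"
  obtain d L where d: "d > 0" and L: "L-lipschitz_on (cball z d \<inter> T) h"
    using h z unfolding locally_lipschitz_on_def by blast
  obtain e M where e: "e > 0" and M: "M-lipschitz_on (cball (h z) e \<inter> S) g"
    using g sub z unfolding locally_lipschitz_on_def by blast
  have L0: "L \<ge> 0" using L by (rule lipschitz_on_nonneg)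
  \<comment> \<open>The radius keeps \<open>h\<close> within \<open>e\<close> of \<open>h z\<close>;
    dividing by \<open>L + 1\<close> instead of \<open>L\<close> covers
    \<open>L = 0\<close>.\<close>
  define r where "r = min d (e / (L + 1))"
  have r: "r > 0" "r \<le> d" using d e L0 by (auto simp: r_def)
  have "r \<le> e / (L + 1)" by (simp add: r_def)
  then have re: "r * (L + 1) \<le> e" using L0 by (simp add: pos_le_divide_eq)
  have "h ` (cball z r \<inter> T) \<subseteq> cball (h z) e \<inter> S"
  proof (rule image_subsetI)
    fix x assume "x \<in> cball z r \<inter> T"
    then have x: "dist z x \<le> r" "x \<in> T" by auto
    have "dist (h z) (h x) \<le> L * dist z x"
      using x z r d by (intro lipschitz_onD[OF L]) auto
    also have "\<dots> \<le> (L + 1) * r"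
      using x L0 by (intro mult_mono) auto
    finally show "h x \<in> cball (h z) e \<inter> S"
      using re sub x by (auto simp: mult.commute)
  qed
  then have "(M * L)-lipschitz_on (cball z r \<inter> T) (\<lambda>x. g (h x))"
    using r(2)
    by (intro lipschitz_on_compose2 lipschitz_on_subset[OF L] lipschitz_on_subset[OF M]) auto
  then show "\<exists>\<epsilon>>0. \<exists>L. L-lipschitz_on (cball z \<epsilon> \<inter> T) (\<lambda>x. g (h x))"
    using r(1) by blast
qed

text \<open>Compactness turns the local constants into a uniform one, as the Gronwall estimate
  requires on the set swept by two solutions.\<close>

lemma locally_lipschitz_on_compact_imp_lipschitz:
  assumes F: "locally_lipschitz_on UNIV F" and K: "compact K"
  obtains L where "L-lipschitz_on K F"
proof -
  \<comment> \<open>The library notion concerns time-dependent vector fields; \<open>F\<close> is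
    viewed as one over the single time 0.\<close>
  have "local_lipschitz {0::real} K (\<lambda>_. F)"
    unfolding local_lipschitz_def
  proof (intro ballI)
    fix x t assume "x \<in> K" "t \<in> {0::real}"
    obtain e L where e: "e > 0" "L-lipschitz_on (cball x e) F"
      using F unfolding locally_lipschitz_on_def by force
    then have "L-lipschitz_on (cball x e \<inter> K) F"
      by (auto intro: lipschitz_on_subset)
    then show "\<exists>u>0. \<exists>L. \<forall>t\<in>cball t u \<inter> {0}. L-lipschitz_on (cball x u \<inter> K) F"
      using e(1) by blast
  qed
  then show ?thesis
    by (rule local_lipschitz_compact_implies_lipschitz[OF _ K, of "{0::real}"]) (auto intro: that)
qed

subsection \<open>Trajectories\<close>

lemma forward_solution_continuous_on:
  assumes "forward_solution F x T X" "ereal t < T"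
  shows "continuous_on {0..t} X"
  unfolding continuous_on_eq_continuous_within
proof
  fix s assume s: "s \<in> {0..t}"
  then have "ereal s < T"
    using assms(2) by (metis atLeastAtMost_iff ereal_less_eq(3) order_le_less_trans)
  then have "(X has_vector_derivative F (X s)) (at s within {0..})"
    using assms(1) s unfolding forward_solution_def by auto
  then show "continuous (at s within {0..t}) X"
    by (meson Icc_subset_Ici_iff continuous_within_subset has_vector_derivative_continuous order_refl)
qed

text \<open>For \<open>0 < s\<close> the half-line \<open>{0..}\<close> is a neighbourhood of
  \<open>s\<close>, so the restriction in \<open>forward_solution\<close> to times in
  \<open>{0..}\<close> drops out.\<close>

lemma forward_solution_interior_derivative:
  assumes "forward_solution F x T X" "ereal t < T" "0 < s" "s \<le> t"
  shows "(X has_vector_derivative F (X s)) (at s)"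
proof -
  have "ereal s < T"
    using assms(2,4) by (metis ereal_less_eq(3) order_le_less_trans)
  then have "(X has_vector_derivative F (X s)) (at s within {0..})"
    using assms(1,3) unfolding forward_solution_def by auto
  then show ?thesis
    using assms(3) at_within_interior[of s "{0..}"] by (simp add: interior_real_atLeast)
qed

text \<open>Gronwall: on the compact set swept by both solutions \<open>F\<close> is \<open>L\<close>-Lipschitz, so
  \<open>e\<^sup>-\<^sup>2\<^sup>L\<^sup>s \<parallel>X\<^sub>s - Y\<^sub>s\<parallel>\<^sup>2\<close> is nonincreasing.\<close>

lemma forward_solution_unique:
  fixes F :: "'a::real_inner \<Rightarrow> 'a"
  assumes F: "locally_lipschitz_on UNIV F"
    and X: "forward_solution F x S X" "ereal t < S"
    and Y: "forward_solution F x T Y" "ereal t < T"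
    and t: "0 \<le> t"
  shows "X t = Y t"
proof -
  note cX = forward_solution_continuous_on[OF X] and cY = forward_solution_continuous_on[OF Y]
  have "compact (X ` {0..t} \<union> Y ` {0..t})"
    by (intro compact_Un compact_continuous_image cX cY compact_Icc)
  then obtain L where L: "L-lipschitz_on (X ` {0..t} \<union> Y ` {0..t}) F"
    using locally_lipschitz_on_compact_imp_lipschitz[OF F] by blast
  define g where "g s = exp (- 2 * L * s) * ((X s - Y s) \<bullet> (X s - Y s))" for s
  have "g t \<le> g 0"
  \<comment> \<open>Derivatives are asked for in the open interval only: at 0 the solutions are
    known to be differentiable just from the right.\<close>
  proof (rule DERIV_nonpos_imp_decreasing_open[OF t])
    show "continuous_on {0..t} g"
      unfolding g_def by (intro continuous_intros cX cY)
    fix s assume s: "0 < s" "s < t"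
    let ?D = "X s - Y s" and ?E = "F (X s) - F (Y s)"
    have dX: "(X has_derivative (\<lambda>h. h *\<^sub>R F (X s))) (at s)"
      and dY: "(Y has_derivative (\<lambda>h. h *\<^sub>R F (Y s))) (at s)"
      using forward_solution_interior_derivative[OF X] forward_solution_interior_derivative[OF Y] s
      by (auto simp: has_vector_derivative_def)
    let ?y = "exp (- 2 * L * s) * (2 * (?D \<bullet> ?E) - 2 * L * (?D \<bullet> ?D))"
    have "(g has_derivative (\<lambda>h. ?y * h)) (at s)"
      unfolding g_def
      by (rule derivative_eq_intros dX dY refl | simp)+
         (auto simp: fun_eq_iff algebra_simps inner_diff_left inner_diff_right inner_commute)
    then have "DERIV g s :> ?y"
      by (simp add: has_field_derivative_def)
    moreover have "?D \<bullet> ?E \<le> L * (?D \<bullet> ?D)"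
    proof -
      have "?D \<bullet> ?E \<le> norm ?D * norm ?E" by (rule norm_cauchy_schwarz)
      also have "\<dots> \<le> norm ?D * (L * norm ?D)"
        using s by (intro mult_left_mono lipschitz_on_normD[OF L]) auto
      finally show ?thesis
        by (simp add: power2_norm_eq_inner[symmetric] power2_eq_square mult_ac)
    qed
    then have "?y \<le> 0"
      by (simp add: mult_le_0_iff)
    ultimately show "\<exists>y. DERIV g s :> y \<and> y \<le> 0" by blast
  qed
  also have "g 0 = 0"
    using X(1) Y(1) by (simp add: g_def forward_solution_def)
  finally have "(X t - Y t) \<bullet> (X t - Y t) \<le> 0"
    unfolding g_def by (simp add: mult_le_0_iff)
  then show ?thesis
    by (simp add: inner_gt_zero_iff flip: not_less)
qed

text \<open>Uniqueness makes the definite description in \<open>trajectory\<close> denote, so any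
  solution living beyond \<open>t\<close> computes it.\<close>

lemma trajectory_eq:
  fixes F :: "'a::real_inner \<Rightarrow> 'a"
  assumes F: "locally_lipschitz_on UNIV F"
    and X: "forward_solution F x T X" "ereal t < T" and t: "0 \<le> t"
  shows "trajectory F x t = X t"
  unfolding trajectory_def
  using X by (intro the_equality) (auto intro: forward_solution_unique[OF F _ _ X t])

text \<open>An infinite \<open>t_max\<close> provides a separate solution for each finite horizon;
  by uniqueness these agree and glue to a global one.\<close>

lemma trajectory_forward_solution:
  fixes F :: "'a::real_inner \<Rightarrow> 'a"
  assumes F: "locally_lipschitz_on UNIV F" and tm: "t_max F x = \<infinity>"
  shows "forward_solution F x \<infinity> (trajectory F x)"
proof -
  have ex: "\<exists>T X. ereal b < T \<and> forward_solution F x T X" for b :: real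
  proof -
    have "ereal b < t_max F x" using tm by simp
    then show ?thesis unfolding t_max_def less_Sup_iff by blast
  qed
  show ?thesis
    unfolding forward_solution_def
  proof (intro conjI allI impI)
    obtain T X where "ereal 0 < T" "forward_solution F x T X" using ex by blast
    then show "trajectory F x 0 = x"
      using trajectory_eq[OF F, of x T X 0] by (simp add: forward_solution_def)
    fix t :: real assume t: "0 \<le> t"
    \<comment> \<open>A horizon beyond \<open>t + 1\<close> lets \<open>trajectory F x\<close> and
      \<open>X\<close> agree at all nonnegative times within distance 1 of \<open>t\<close>, enough
      to transfer the derivative.\<close>
    obtain T X where T: "ereal (t + 1) < T" and X: "forward_solution F x T X" using ex by blast
    have eq: "trajectory F x s = X s" if "0 \<le> s" "s < t + 1" for s
    proof (rule trajectory_eq[OF F X _ that(1)])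
      show "ereal s < T" using T that(2) by (metis ereal_less_eq(3) less_imp_le order_le_less_trans)
    qed
    have "ereal t < T" using T by (metis ereal_less_eq(3) le_add_same_cancel1 order_le_less_trans zero_le_one)
    then have "(X has_vector_derivative F (X t)) (at t within {0..})"
      using X t unfolding forward_solution_def by blast
    then have "(trajectory F x has_vector_derivative F (X t)) (at t within {0..})"
      by (rule has_vector_derivative_transform_within[of _ _ _ _ 1])
         (use t in \<open>auto intro!: eq[symmetric] simp: dist_real_def\<close>)
    then show "(trajectory F x has_vector_derivative F (trajectory F x t)) (at t within {0..})"
      using eq[of t] t by simp
  qed
qed

text \<open>Flow property: the equation is autonomous, so the time-shifted trajectory solves it from
  the state at time \<open>s\<close>, and uniqueness applies.\<close>

lemma trajectory_shift:
  fixes F :: "'a::real_inner \<Rightarrow> 'a"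
  assumes F: "locally_lipschitz_on UNIV F" and tm: "t_max F x = \<infinity>"
    and s: "0 \<le> s" and t: "0 \<le> t"
  shows "trajectory F (trajectory F x s) t = trajectory F x (t + s)"
proof -
  let ?X = "trajectory F x"
  have X: "forward_solution F x \<infinity> ?X" by (rule trajectory_forward_solution[OF F tm])
  have "forward_solution F (?X s) \<infinity> (\<lambda>t. ?X (t + s))"
    unfolding forward_solution_def
  proof (intro conjI allI impI)
    fix r :: real assume r: "0 \<le> r"
    have "(?X has_vector_derivative F (?X (r + s))) (at (r + s) within {0..})"
      using X r s unfolding forward_solution_def by auto
    \<comment> \<open>The chain rule asks for the derivative within the image of
      \<open>{0..}\<close> under the shift, which is \<open>{s..}\<close> and lies in
      \<open>{0..}\<close>.\<close>
    then have "(?X has_vector_derivative F (?X (r + s))) (at (r + s) within (\<lambda>t. t + s) ` {0..})"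
      by (rule has_vector_derivative_within_subset) (use s in auto)
    moreover have "((\<lambda>t. t + s) has_vector_derivative 1) (at r within {0..})"
      by (auto intro!: derivative_eq_intros)
    ultimately have "((?X \<circ> (\<lambda>t. t + s)) has_vector_derivative 1 *\<^sub>R F (?X (r + s))) (at r within {0..})"
      by (intro vector_diff_chain_within)
    then show "((\<lambda>t. ?X (t + s)) has_vector_derivative F (?X (r + s))) (at r within {0..})"
      by (simp add: o_def)
  qed simp
  from trajectory_eq[OF F this _ t] show ?thesis by simp
qed

text \<open>Provides integrability of the running cost on bounded intervals, on which the integral
  manipulations below rest.\<close>

lemma discounted_cost_continuous_on:
  fixes F :: "'a::real_inner \<Rightarrow> 'a"
  assumes "locally_lipschitz_on UNIV F" "t_max F x = \<infinity>" "continuous_on UNIV q" "0 < \<gamma>"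
  shows "continuous_on {0..t} (\<lambda>t. \<gamma> powr t * (q (trajectory F x t)::real))"
proof -
  have "continuous_on {0..t} (trajectory F x)"
    by (rule forward_solution_continuous_on[OF trajectory_forward_solution[OF assms(1,2)]]) simp
  then have "continuous_on {0..t} (\<lambda>t. q (trajectory F x t))"
    by (rule continuous_on_compose2[OF assms(3)]) auto
  then show ?thesis
    using assms(4) by (intro continuous_intros) auto
qed

subsection \<open>The Bellman equation\<close>

text \<open>Applying the one-step equation at the state reached at time
  \<open>s = n * \<eta>\<close>, with weight \<open>\<gamma> powr s\<close>, lengthens the horizon
  by \<open>\<eta>\<close>.\<close>

lemma bellman_iterate:
  fixes F :: "'a::real_inner \<Rightarrow> 'a" and q v :: "'a \<Rightarrow> real"
  assumes F: "locally_lipschitz_on UNIV F" and tm: "\<And>x. t_max F x = \<infinity>"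
    and q: "continuous_on UNIV q" and \<gamma>: "0 < \<gamma>" and \<eta>: "0 < \<eta>"
    and v: "\<And>x. v x = - integral {0..\<eta>} (\<lambda>t. \<gamma> powr t * q (trajectory F x t))
              + \<gamma> powr \<eta> * v (trajectory F x \<eta>)"
  shows "v x = - integral {0..real n * \<eta>} (\<lambda>t. \<gamma> powr t * q (trajectory F x t))
              + \<gamma> powr (real n * \<eta>) * v (trajectory F x (real n * \<eta>))"
proof (induction n)
  case 0
  have "trajectory F x 0 = x"
    using trajectory_forward_solution[OF F tm] by (simp add: forward_solution_def)
  then show ?case using \<gamma> by simp
next
  case (Suc n)
  let ?g = "\<lambda>t. \<gamma> powr t * q (trajectory F x t)"
  define s where "s = real n * \<eta>"
  have s: "0 \<le> s" "real (Suc n) * \<eta> = \<eta> + s"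
    using \<eta> by (auto simp: s_def algebra_simps)
  have c: "continuous_on {0..b} ?g" for b
    by (rule discounted_cost_continuous_on[OF F tm q \<gamma>])
  have "\<gamma> powr s * integral {0..\<eta>} (\<lambda>t. \<gamma> powr t * q (trajectory F (trajectory F x s) t))
      = integral {0..\<eta>} (\<lambda>t. \<gamma> powr s * (\<gamma> powr t * q (trajectory F (trajectory F x s) t)))"
    by simp
  \<comment> \<open>The weight \<open>\<gamma> powr s\<close> merges with the discount, and the flow
    property replaces the restarted trajectory by the original one at time
    \<open>t + s\<close>.\<close>
  also have "\<dots> = integral {0..\<eta>} (?g \<circ> (\<lambda>t. t + s))"
    by (rule integral_cong) (use s in \<open>simp add: trajectory_shift[OF F tm] powr_add\<close>)
  also have "\<dots> = integral {0 + s..\<eta> + s} ?g"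
    by (rule integral_shift) (use s in \<open>auto intro: continuous_on_subset[OF c]\<close>)
  finally have sh: "\<gamma> powr s * integral {0..\<eta>} (\<lambda>t. \<gamma> powr t * q (trajectory F (trajectory F x s) t))
      = integral {s..\<eta> + s} ?g" by simp
  have comb: "integral {0..s} ?g + integral {s..\<eta> + s} ?g = integral {0..\<eta> + s} ?g"
    using s \<eta> by (intro Henstock_Kurzweil_Integration.integral_combine integrable_continuous_real c) auto
  have "\<gamma> powr s * v (trajectory F x s) =
      - integral {s..\<eta> + s} ?g + \<gamma> powr (\<eta> + s) * v (trajectory F x (\<eta> + s))"
    using s \<eta> by (subst v) (simp add: algebra_simps sh trajectory_shift[OF F tm] powr_add)
  then show ?case
    using Suc comb unfolding s(2) s_def[symmetric] by simp
qed

text \<open>The sampling times \<open>n * \<eta>\<close> suffice because a nonnegative cost makes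
  the partial integrals monotone. Stated with \<open>has_integral\<close>, the conclusion contains
  finiteness of the total cost besides its value.\<close>

lemma bellman_imp_total_cost:
  fixes F :: "'a::real_inner \<Rightarrow> 'a" and q v :: "'a \<Rightarrow> real"
  assumes F: "locally_lipschitz_on UNIV F" and att: "globally_attractive F"
    and q: "continuous_on UNIV q" "\<And>x. 0 \<le> q x" and \<gamma>: "0 < \<gamma>" "\<gamma> \<le> 1" and \<eta>: "0 < \<eta>"
    and v0: "isCont v 0" "v 0 = 0"
    and v: "\<And>x. v x = - integral {0..\<eta>} (\<lambda>t. \<gamma> powr t * q (trajectory F x t))
              + \<gamma> powr \<eta> * v (trajectory F x \<eta>)"
  shows "((\<lambda>t. \<gamma> powr t * q (trajectory F x t)) has_integral - v x) {0..}"
proof -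
  have tm: "t_max F x = \<infinity>" for x using att by (simp add: globally_attractive_def)
  let ?X = "trajectory F x"
  let ?g = "\<lambda>t. \<gamma> powr t * q (?X t)"
  let ?T = "\<lambda>n. real n * \<eta>"
  have T: "filterlim ?T at_top sequentially"
    using \<eta> by (intro filterlim_at_top_mult_tendsto_pos[OF tendsto_const] filterlim_real_sequentially) auto
  have "(?X \<longlongrightarrow> 0) at_top" using att by (simp add: globally_attractive_def)
  then have "(\<lambda>n. ?X (?T n)) \<longlonglongrightarrow> 0" by (rule filterlim_compose[OF _ T])
  then have vX: "(\<lambda>n. v (?X (?T n))) \<longlonglongrightarrow> 0"
    using isCont_tendsto_compose[OF v0(1)] v0(2) by force
  \<comment> \<open>Since \<open>\<gamma> = 1\<close> is allowed, the decay is drawn from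
    \<open>v\<close> along the trajectory; the discount contributes the bound 1.\<close>
  have "(\<lambda>n. \<gamma> powr ?T n * v (?X (?T n))) \<longlonglongrightarrow> 0"
  proof (rule tendsto_norm_zero_cancel, rule tendsto_sandwich[OF _ _ tendsto_const])
    show "(\<lambda>n. norm (v (?X (?T n)))) \<longlonglongrightarrow> 0" using vX by (rule tendsto_norm_zero)
    have "\<gamma> powr ?T n \<le> 1" for n using \<gamma> \<eta> by (intro powr_le1) auto
    then show "\<forall>\<^sub>F n in sequentially. norm (\<gamma> powr ?T n * v (?X (?T n))) \<le> norm (v (?X (?T n)))"
      by (intro always_eventually allI) (auto simp: abs_mult intro: mult_left_le_one_le)
  qed auto
  then have "(\<lambda>n. \<gamma> powr ?T n * v (?X (?T n)) - v x) \<longlonglongrightarrow> 0 - v x"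
    by (intro tendsto_diff tendsto_const)
  moreover have "integral {0..?T n} ?g = \<gamma> powr ?T n * v (?X (?T n)) - v x" for n
    using bellman_iterate[where v = v and n = n and x = x, OF F tm q(1) \<gamma>(1) \<eta> v] by linarith
  ultimately have lim: "(\<lambda>n. integral {0..?T n} ?g) \<longlonglongrightarrow> - v x"
    by simp
  show ?thesis
  proof (rule has_integral_monotone_convergence_increasing)
    \<comment> \<open>Monotone convergence is applied to the integrand cut off at
      \<open>n * \<eta>\<close> and extended by 0 to the half-line; it increases with
      \<open>n\<close> as \<open>q\<close> is nonnegative.\<close>
    show "((\<lambda>t. if t \<in> {0..?T n} then ?g t else 0) has_integral integral {0..?T n} ?g) {0..}" for n
      by (subst has_integral_restrict)
         (auto intro!: integrable_integral integrable_continuous_real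
           discounted_cost_continuous_on[OF F tm q(1) \<gamma>(1)])
    show "(if t \<in> {0..?T n} then ?g t else 0) \<le> (if t \<in> {0..?T (Suc n)} then ?g t else 0)" for t n
      using q(2) \<eta> by (auto simp: algebra_simps)
    show "(\<lambda>n. if t \<in> {0..?T n} then ?g t else 0) \<longlonglongrightarrow> ?g t" if "t \<in> {0..}" for t
    proof (rule tendsto_eventually)
      have "\<forall>\<^sub>F n in sequentially. t \<le> ?T n" using T by (simp add: filterlim_at_top)
      then show "\<forall>\<^sub>F n in sequentially. (if t \<in> {0..?T n} then ?g t else 0) = ?g t"
        by eventually_elim (use that in auto)
    qed
  qed (rule lim)
qed

section \<open>The differential equation for the value along trajectories\<close>

text \<open>A vector is determined by its inner products, so gradients are unique and the definite
  description in \<open>gradient\<close> denotes.\<close>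

lemma GDERIV_gradient:
  fixes v :: "'a::real_inner \<Rightarrow> real"
  assumes "C1 v"
  shows "GDERIV v x :> gradient v x"
proof -
  obtain D where D: "GDERIV v x :> D" using assms unfolding C1_def by blast
  have "D' = D" if "GDERIV v x :> D'" for D'
  proof -
    have "(\<lambda>h. h \<bullet> D') = (\<lambda>h. h \<bullet> D)"
      using that D unfolding gderiv_def by (rule has_derivative_unique)
    then show ?thesis by (metis inner_commute vector_eq_rdot)
  qed
  with D show ?thesis unfolding gradient_def by (metis theI)
qed

text \<open>The product rule for \<open>\<gamma> powr t * v (X t)\<close> produces the term
  \<open>ln \<gamma> * v\<close>, which \<open>hj\<close> trades for \<open>q\<close> minus the
  derivative of \<open>v\<close> along \<open>F\<close>. The running cost remains, and integrating
  it gives the equation over any horizon.\<close>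

lemma hamilton_jacobi_imp_bellman:
  fixes F :: "'a::real_inner \<Rightarrow> 'a" and q v :: "'a \<Rightarrow> real"
  assumes F: "locally_lipschitz_on UNIV F" and tm: "t_max F x = \<infinity>"
    and \<gamma>: "0 < \<gamma>" and \<eta>: "0 \<le> \<eta>" and v: "C1 v"
    and hj: "\<And>x. - ln \<gamma> * v x = - q x + gradient v x \<bullet> F x"
  shows "v x = - integral {0..\<eta>} (\<lambda>t. \<gamma> powr t * q (trajectory F x t))
              + \<gamma> powr \<eta> * v (trajectory F x \<eta>)"
proof -
  let ?X = "trajectory F x"
  have X: "forward_solution F x \<infinity> ?X" by (rule trajectory_forward_solution[OF F tm])
  have "((\<lambda>t. \<gamma> powr t * q (?X t)) has_integral \<gamma> powr \<eta> * v (?X \<eta>) - \<gamma> powr 0 * v (?X 0)) {0..\<eta>}"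
  proof (rule fundamental_theorem_of_calculus[OF \<eta>])
    fix t assume t: "t \<in> {0..\<eta>}"
    have dg: "((\<lambda>t. \<gamma> powr t) has_field_derivative \<gamma> powr t * ln \<gamma>) (at t within {0..\<eta>})"
      by (rule has_field_derivative_at_within) (use \<gamma> in \<open>auto intro!: derivative_eq_intros\<close>)
    have "(?X has_vector_derivative F (?X t)) (at t within {0..\<eta>})"
      using X t unfolding forward_solution_def
      by (auto intro: has_vector_derivative_within_subset)
    then have dX: "(?X has_derivative (\<lambda>h. h *\<^sub>R F (?X t))) (at t within {0..\<eta>})"
      by (simp add: has_vector_derivative_def)
    have "(v has_derivative (\<lambda>h. h \<bullet> gradient v (?X t))) (at (?X t))"
      using GDERIV_gradient[OF v] by (simp add: gderiv_def)
    from has_derivative_compose[OF dX this]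
    have "((\<lambda>t. v (?X t)) has_field_derivative gradient v (?X t) \<bullet> F (?X t)) (at t within {0..\<eta>})"
      by (simp add: has_field_derivative_def inner_commute mult.commute[of _ "_ \<bullet> _"])
    from DERIV_mult'[OF dg this] have "((\<lambda>t. \<gamma> powr t * v (?X t)) has_field_derivative
        \<gamma> powr t * (gradient v (?X t) \<bullet> F (?X t)) + \<gamma> powr t * ln \<gamma> * v (?X t)) (at t within {0..\<eta>})" .
    moreover have "\<gamma> powr t * (gradient v (?X t) \<bullet> F (?X t)) + \<gamma> powr t * ln \<gamma> * v (?X t)
        = \<gamma> powr t * (gradient v (?X t) \<bullet> F (?X t) - (- ln \<gamma> * v (?X t)))"
      by (simp add: algebra_simps)
    moreover have "\<dots> = \<gamma> powr t * q (?X t)"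
      unfolding hj by simp
    ultimately show "((\<lambda>t. \<gamma> powr t * v (?X t)) has_vector_derivative \<gamma> powr t * q (?X t)) (at t within {0..\<eta>})"
      by (simp only: has_real_derivative_iff_has_vector_derivative)
  qed
  moreover have "?X 0 = x" using X by (simp add: forward_solution_def)
  ultimately show ?thesis
    using \<gamma> by (simp add: integral_unique)
qed

theorem theorem5p16:
  fixes U :: "(real ^ 'm) set"
    and f :: "(real ^ 'l) \<times> (real ^ 'm) \<Rightarrow> real ^ 'l"
    and c :: "(real ^ 'l) \<times> (real ^ 'm) \<Rightarrow> real"
    and u_star :: "(real ^ 'l) \<times> (real ^ 'l) \<Rightarrow> real ^ 'm"
    and \<gamma> :: real
    and \<pi> :: "real ^ 'l \<Rightarrow> real ^ 'm"
    and v :: "real ^ 'l \<Rightarrow> real"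
  assumes action_space: "action_space U"
    and f_lipschitz: "locally_lipschitz_on (UNIV \<times> U) f"
    and f_zero: "f (0, 0) = 0"
    and c_continuous: "continuous_on (UNIV \<times> U) c"
    and c_positive_definite: "positive_definite_on (UNIV \<times> U) c"
    and discount: "0 < \<gamma>" "\<gamma> \<le> 1"
    and u_star_lipschitz: "locally_lipschitz_on UNIV u_star"
    and u_star_maximal:
      "\<And>x p. is_arg_max (\<lambda>u. hamiltonian f c x u p) (\<lambda>u. u \<in> U) (u_star (x, p))"
    and admissible_nonempty: "admissible U f c \<gamma> \<noteq> {}"
    and value_regular:
      "\<And>\<mu>. \<mu> \<in> admissible U f c \<gamma> \<Longrightarrow>
         C1 (\<lambda>x. real_of_ereal (value_function f c \<gamma> \<mu> x)) \<and>
         locally_lipschitz_on UNIV (gradient (\<lambda>x. real_of_ereal (value_function f c \<gamma> \<mu> x)))"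
    and cost_nonvanishing: "\<And>\<mu>. \<mu> \<in> Pi0 U \<Longrightarrow> radially_nonvanishing (closed_loop c \<mu>)"
    and pi: "\<pi> \<in> Pi0 U"
    and attractive: "globally_attractive (closed_loop f \<pi>)"
    and v_continuous: "isCont v 0"
    and v_zero: "v 0 = 0"
    and bellman:
      "(\<exists>\<eta>>0. \<forall>x. v x =
          (LINT t:{0..\<eta>}|lborel. \<gamma> powr t * closed_loop (reward c) \<pi> (trajectory (closed_loop f \<pi>) x t))
          + \<gamma> powr \<eta> * v (trajectory (closed_loop f \<pi>) x \<eta>))
       \<or> (C1 v \<and> (\<forall>x. - ln \<gamma> * v x = hamiltonian f c x (\<pi> x) (gradient v x)))"
  shows "\<pi> \<in> admissible U f c \<gamma> \<and> (\<forall>x. ereal (v x) = value_function f c \<gamma> \<pi> x)"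
proof -
  let ?F = "closed_loop f \<pi>" and ?q = "closed_loop c \<pi>"
  have \<pi>: "continuous_on UNIV \<pi>" "\<And>x. \<pi> x \<in> U" "locally_lipschitz_on UNIV \<pi>"
    using pi unfolding Pi0_def policies_def by auto
  have F: "locally_lipschitz_on UNIV ?F"
    unfolding closed_loop_def
  proof (rule locally_lipschitz_on_compose[OF _ f_lipschitz])
    show "locally_lipschitz_on UNIV (\<lambda>x. (x, \<pi> x))"
      by (rule locally_lipschitz_on_Pair[OF lipschitz_on_imp_locally_lipschitz_on[OF lipschitz_on_id] \<pi>(3)])
  qed (use \<pi>(2) in auto)
  have q: "continuous_on UNIV ?q"
    unfolding closed_loop_def
    by (rule continuous_on_compose2[OF c_continuous]) (use \<pi> in \<open>auto intro!: continuous_intros\<close>)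
  have q0: "0 \<le> ?q x" for x
    using c_positive_definite \<pi>(2)[of x] unfolding closed_loop_def positive_definite_on_def
    by (cases "(x, \<pi> x) = 0") (auto intro: less_imp_le)
  have tm: "t_max ?F x = \<infinity>" for x using attractive by (simp add: globally_attractive_def)
  have "\<exists>\<eta>>0. \<forall>x. v x = - integral {0..\<eta>} (\<lambda>t. \<gamma> powr t * ?q (trajectory ?F x t))
              + \<gamma> powr \<eta> * v (trajectory ?F x \<eta>)"
    using bellman
  proof
    assume "C1 v \<and> (\<forall>x. - ln \<gamma> * v x = hamiltonian f c x (\<pi> x) (gradient v x))"
    then have "C1 v" and hj: "\<And>x. - ln \<gamma> * v x = - ?q x + gradient v x \<bullet> ?F x"
      by (auto simp: hamiltonian_def reward_def closed_loop_def)
    \<comment> \<open>Every horizon is available here; 1 serves as the positive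
      \<open>\<eta>\<close>.\<close>
    from hamilton_jacobi_imp_bellman[where q = ?q and v = v, OF F tm discount(1) zero_le_one this]
    show ?thesis by (intro exI[of _ 1] conjI zero_less_one allI)
  next
    have "(LINT t:{0..\<eta>}|lborel. \<gamma> powr t * closed_loop (reward c) \<pi> (trajectory ?F x t))
        = - integral {0..\<eta>} (\<lambda>t. \<gamma> powr t * ?q (trajectory ?F x t))" for \<eta> x
    proof -
      \<comment> \<open>Continuity on a compact interval makes the Lebesgue and the gauge integral
        agree.\<close>
      have "continuous_on {0..\<eta>} (\<lambda>t. - (\<gamma> powr t * ?q (trajectory ?F x t)))"
        by (intro continuous_on_minus discounted_cost_continuous_on[OF F tm q discount(1)])
      from set_borel_integral_eq_integral(2)[OF borel_integrable_atLeastAtMost'[OF this]]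
      show ?thesis by (simp add: reward_def closed_loop_def)
    qed
    moreover assume "\<exists>\<eta>>0. \<forall>x. v x =
          (LINT t:{0..\<eta>}|lborel. \<gamma> powr t * closed_loop (reward c) \<pi> (trajectory ?F x t))
          + \<gamma> powr \<eta> * v (trajectory ?F x \<eta>)"
    ultimately show ?thesis by simp
  qed
  then have int: "((\<lambda>t. \<gamma> powr t * ?q (trajectory ?F x t)) has_integral - v x) {0..}" for x
    using bellman_imp_total_cost[OF F attractive q q0 discount _ v_continuous v_zero] by blast
  \<comment> \<open>This sign ensures that \<open>ennreal (- v x)\<close> truncates nothing when the
    cost is turned back into an \<open>ereal\<close>.\<close>
  have v: "v x \<le> 0" for x
    using has_integral_nonneg[OF int[of x]] q0 by simp
  \<comment> \<open>For a nonnegative integrand the gauge integral equals the Lebesgue integral in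
    \<open>cost_value\<close>, whose first branch is selected by the infinite existence time. A real
    value means finite cost, hence admissibility.\<close>
  have "cost_value f c \<gamma> \<pi> x = ennreal (- v x)" for x
    using nn_integral_has_integral_lebesgue[OF _ int[of x]] q0 tm[of x]
    by (simp add: cost_value_def ennreal_mult' ennreal_indicator mult.commute)
  then show ?thesis
    using pi v by (simp add: admissible_def value_function_def enn2ereal_ennreal)
qed

end
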